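(* Consider S-AUS, with sensor nodes $\mathcal{S}=\{1,\dots,S\}$, uniform travel time $r$ from the base station and common AoI cost function $f(\cdot)$, and consider $M$ consecutive trips of the UAV. Then visiting the sensor node with the largest AoI in each trip (i.e., in each trip, a sensor node whose AoI at the departure time of that trip is the largest among all sensor nodes) results in optimum average AoI.
   Context: Setting (S-AUS, symmetric age-optimal UAV scheduling). A UAV collects data from sensor nodes (SNs) $\mathcal{S}=\{1,\dots,S\}$ and delivers it to a base station (BS). All SNs have uniform travel time $r$ from the BS and a common AoI cost function $f(\cdot)$, which assigns a cost $f(x)$ to an AoI value $x$. The battery, when fully charged, allows for an operation time of $2r$. A trip means getting to one SN from the BS, collecting the information, and returning to the BS; a schedule of the UAV consists of a sequence of trips, and all trips have the same length $2r$. A solution for $M$ consecutive trips, departing from the BS at times $t_1,\dots,t_M$, specifies which SN is visited in each trip. In a trip to SN $i$ departing at time $t_k$, the UAV collects at SN $i$ information with timestamp $t_k+r$ and delivers it to the BS at time $t_k+2r$. The age of information (AoI) of SN $s$ at time $t$ is $a(s,t)=t-u(s,t)$, where $u(s,t)$ is the timestamp of the most recently received information of SN $s$ available at the BS at time $t$. Thus the AoI of every SN grows at unit rate, except that when a trip to SN $i$ departing at $t_k$ is completed at time $t_k+2r$, the AoI of SN $i$ becomes $r$. "Average AoI" refers to the average over all SNs and over the time period considered, and "optimum" means minimum over all solutions for the $M$ trips. The general objective of the scheduling problem is to minimize the overall average AoI cost of all SNs, i.e. the average of $f(a(s,t))$. *)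

theory Defs
  imports "HOL-Analysis.Analysis"
begin

text \<open>
  The sensor nodes are \<open>{1..S}\<close>, the trips \<open>{1..M}\<close>; trip \<open>k\<close> departs at time \<open>dep k\<close>.
  A solution \<open>v\<close> maps each trip to the sensor node it visits (values outside \<open>{1..M}\<close> are
  irrelevant).
\<close>

definition solutions :: "nat \<Rightarrow> nat \<Rightarrow> (nat \<Rightarrow> nat) set" where
  "solutions S M = {1..M} \<rightarrow> {1..S}"

definition delivered ::
  "nat \<Rightarrow> real \<Rightarrow> (nat \<Rightarrow> real) \<Rightarrow> (nat \<Rightarrow> nat) \<Rightarrow> nat \<Rightarrow> real \<Rightarrow> nat set" where
  "delivered M r dep v s t = {k \<in> {1..M}. v k = s \<and> dep k + 2 * r \<le> t}"

text \<open>
  \<open>u0 s\<close> is the timestamp of the information of \<open>s\<close> that the base station holds when the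
  first trip departs; it stays the most recent one until \<open>s\<close> is first delivered. As departure
  times increase, the largest index in \<open>delivered\<close> belongs to the most recent reception.
\<close>

definition latest_timestamp ::
  "nat \<Rightarrow> real \<Rightarrow> (nat \<Rightarrow> real) \<Rightarrow> (nat \<Rightarrow> real) \<Rightarrow> (nat \<Rightarrow> nat) \<Rightarrow> nat \<Rightarrow> real \<Rightarrow> real" where
  "latest_timestamp M r dep u0 v s t =
     (if delivered M r dep v s t = {} then u0 s
      else dep (Max (delivered M r dep v s t)) + r)"

definition aoi ::
  "nat \<Rightarrow> real \<Rightarrow> (nat \<Rightarrow> real) \<Rightarrow> (nat \<Rightarrow> real) \<Rightarrow> (nat \<Rightarrow> nat) \<Rightarrow> nat \<Rightarrow> real \<Rightarrow> real" where
  "aoi M r dep u0 v s t = t - latest_timestamp M r dep u0 v s t"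

definition average_aoi_cost ::
  "nat \<Rightarrow> nat \<Rightarrow> real \<Rightarrow> (nat \<Rightarrow> real) \<Rightarrow> (nat \<Rightarrow> real) \<Rightarrow> real \<Rightarrow> (real \<Rightarrow> real) \<Rightarrow>
   (nat \<Rightarrow> nat) \<Rightarrow> real" where
  "average_aoi_cost S M r dep u0 T f v =
     (\<Sum>s = 1..S. integral {dep 1..T} (\<lambda>t. f (aoi M r dep u0 v s t)) / (T - dep 1)) / real S"

definition average_aoi ::
  "nat \<Rightarrow> nat \<Rightarrow> real \<Rightarrow> (nat \<Rightarrow> real) \<Rightarrow> (nat \<Rightarrow> real) \<Rightarrow> real \<Rightarrow> (nat \<Rightarrow> nat) \<Rightarrow> real" where
  "average_aoi S M r dep u0 T v =
     (\<Sum>s = 1..S. integral {dep 1..T} (\<lambda>t. aoi M r dep u0 v s t) / (T - dep 1)) / real S"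

definition visits_largest_aoi ::
  "nat \<Rightarrow> nat \<Rightarrow> real \<Rightarrow> (nat \<Rightarrow> real) \<Rightarrow> (nat \<Rightarrow> real) \<Rightarrow> (nat \<Rightarrow> nat) \<Rightarrow> bool" where
  "visits_largest_aoi S M r dep u0 v \<longleftrightarrow>
     (\<forall>k \<in> {1..M}. is_arg_max (\<lambda>s. aoi M r dep u0 v s (dep k)) (\<lambda>s. s \<in> {1..S}) (v k))"

end

theory Submission
  imports Defs "HOL-Combinatorics.Transposition"
begin

text \<open>
  At every moment the timestamps produced by the largest-AoI rule dominate those of any other
  solution up to a permutation of the sensor nodes: overwriting the smallest timestamp, rather
  than an arbitrary one, by the same new value preserves domination, after composing the
  permutation with one transposition. Hence for every nondecreasing \<open>f\<close> the total cost of the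
  rule is minimal at each point in time, and the claim follows by integration; the average AoI
  is the case of the identity.
\<close>

section \<open>Auxiliary facts: exchanging a minimum, gluing integrals\<close>

text \<open>With \<open>i'\<close> the preimage of \<open>j\<close> under \<open>\<pi>\<close>, the
  new permutation pairs the two overwritten entries, \<open>i\<close> with \<open>j\<close>, and
  gives \<open>i'\<close> the former partner \<open>\<pi> i\<close> of \<open>i\<close>. Minimality
  of \<open>a i\<close> makes the latter safe:
  \<open>b (\<pi> i) \<le> a i \<le> a i'\<close>.\<close>

lemma replace_min_dominates:
  fixes a b :: "'a \<Rightarrow> 'b::preorder"
  assumes \<pi>: "bij_betw \<pi> A A" and le: "\<And>s. s \<in> A \<Longrightarrow> b (\<pi> s) \<le> a s"
    and i: "i \<in> A" "\<And>s. s \<in> A \<Longrightarrow> a i \<le> a s" and j: "j \<in> A"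
  shows "\<exists>\<pi>'. bij_betw \<pi>' A A \<and> (\<forall>s\<in>A. (b(j := c)) (\<pi>' s) \<le> (a(i := c)) s)"
proof -
  obtain i' where i': "i' \<in> A" "\<pi> i' = j"
    using \<pi> j by (metis bij_betw_imp_surj_on imageE)
  have inj: "\<pi> s = j \<longleftrightarrow> s = i'" if "s \<in> A" for s
    using \<pi> i' that by (auto simp: bij_betw_def inj_on_def)
  have "bij_betw (Transposition.transpose i i') A A"
    by (rule bij_betw_byWitness[where f' = "Transposition.transpose i i'"]) (use i i' in \<open>auto simp: Transposition.transpose_def\<close>)
  then have "bij_betw (\<pi> \<circ> Transposition.transpose i i') A A"
    using \<pi> by (rule bij_betw_trans)
  moreover have "(b(j := c)) ((\<pi> \<circ> Transposition.transpose i i') s) \<le> (a(i := c)) s" if "s \<in> A" for s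
  proof -
    have "b (\<pi> i) \<le> a i'"
      using le[OF i(1)] i(2)[OF i'(1)] by (rule order_trans)
    then show ?thesis
      using that i i' le inj by (auto simp: Transposition.transpose_def)
  qed
  ultimately show ?thesis by blast
qed

text \<open>The conjunct \<open>a 0 \<le> a N\<close> is carried through the induction because
  joining two intervals needs their endpoints in order.\<close>

lemma integrable_on_concat:
  fixes g :: "real \<Rightarrow> 'a::banach" and a :: "nat \<Rightarrow> real"
  assumes "\<And>n. n < N \<Longrightarrow> a n \<le> a (Suc n)"
    and "\<And>n. n < N \<Longrightarrow> g integrable_on {a n..a (Suc n)}"
  shows "a 0 \<le> a N \<and> g integrable_on {a 0..a N}"
  using assms
proof (induction N)
  case (Suc N)
  then have "a 0 \<le> a N" "g integrable_on {a 0..a N}" "a N \<le> a (Suc N)"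
    "g integrable_on {a N..a (Suc N)}"
    by auto
  then show ?case
    by (meson Henstock_Kurzweil_Integration.integrable_combine order_trans)
qed (metis box_real(2) integrable_on_refl order_refl)

section \<open>Timestamps and the order of deliveries\<close>

locale uav_trips =
  fixes S M :: nat and r T :: real and dep u0 :: "nat \<Rightarrow> real"
  assumes M_ge: "M \<ge> 1" and r_pos: "r > 0"
    and dep_step: "\<And>k. 1 \<le> k \<Longrightarrow> k < M \<Longrightarrow> dep k + 2 * r \<le> dep (k + 1)"
    and u0_le: "\<And>s. s \<in> {1..S} \<Longrightarrow> u0 s \<le> dep 1"
    and T_ge: "dep M + 2 * r \<le> T"
begin

text \<open>Recursive form of \<open>latest_timestamp\<close>, indexed by the number of deliveries
  instead of time. Each delivery is a function update, as \<open>replace_min_dominates\<close>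
  requires.\<close>

primrec stamp :: "(nat \<Rightarrow> nat) \<Rightarrow> nat \<Rightarrow> nat \<Rightarrow> real" where
  "stamp w 0 = u0"
| "stamp w (Suc n) = (stamp w n)(w (Suc n) := dep (Suc n) + r)"

lemma dep_less:
  assumes "1 \<le> j" "j < k" "k \<le> M"
  shows "dep j + 2 * r \<le> dep k"
  using assms(2,3)
proof (induction k)
  case (Suc k)
  have "dep j + 2 * r \<le> dep k \<or> j = k"
    using Suc by (cases "j = k") auto
  moreover have "dep k + 2 * r \<le> dep (Suc k)"
    using dep_step[of k] assms(1) Suc.prems by simp
  ultimately show ?case using r_pos by auto
qed simp

lemma dep_mono:
  assumes "1 \<le> j" "j \<le> k" "k \<le> M"
  shows "dep j \<le> dep k"
  using dep_less[of j k] assms r_pos by (cases "j = k") auto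

lemma stamp_eq:
  "stamp w n s = (if {k \<in> {1..n}. w k = s} = {} then u0 s else dep (Max {k \<in> {1..n}. w k = s}) + r)"
proof (induction n)
  case (Suc n)
  show ?case
  proof (cases "w (Suc n) = s")
    case True
    then have "Max {k \<in> {1..Suc n}. w k = s} = Suc n"
      by (intro Max_eqI) auto
    then show ?thesis using True by auto
  next
    case False
    then have "{k \<in> {1..Suc n}. w k = s} = {k \<in> {1..n}. w k = s}"
      by (auto simp: le_Suc_eq)
    then show ?thesis using Suc False by auto
  qed
qed simp

lemma latest_timestamp_eq_stamp:
  assumes "n \<le> M" and "\<And>k. k \<in> {1..M} \<Longrightarrow> dep k + 2 * r \<le> t \<longleftrightarrow> k \<le> n"
  shows "latest_timestamp M r dep u0 w s t = stamp w n s"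
proof -
  have "delivered M r dep w s t = {k \<in> {1..n}. w k = s}"
    using assms by (auto simp: delivered_def)
  then show ?thesis by (simp only: latest_timestamp_def stamp_eq)
qed

text \<open>Delivery times increase with the trip index, so the trips delivered by time
  \<open>t\<close> form an initial segment. Its length does not depend on the solution, so two
  solutions can be compared at the same \<open>n\<close>.\<close>

lemma ex_delivered_count:
  obtains n where "n \<le> M" "\<And>k. k \<in> {1..M} \<Longrightarrow> dep k + 2 * r \<le> t \<longleftrightarrow> k \<le> n"
proof -
  \<comment> \<open>Inserting 0 gives \<open>n = 0\<close> when nothing has been delivered
    yet.\<close>
  define n where "n = Max (insert 0 {k \<in> {1..M}. dep k + 2 * r \<le> t})"
  have n: "n \<in> insert 0 {k \<in> {1..M}. dep k + 2 * r \<le> t}"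
    unfolding n_def by (rule Max_in) auto
  show ?thesis
  proof (rule that)
    show "n \<le> M" using n by auto
    fix k assume k: "k \<in> {1..M}"
    show "dep k + 2 * r \<le> t \<longleftrightarrow> k \<le> n"
    proof
      assume "dep k + 2 * r \<le> t"
      then show "k \<le> n" using k unfolding n_def by (intro Max_ge) auto
    next
      assume "k \<le> n"
      then have "dep k \<le> dep n" "dep n + 2 * r \<le> t"
        using k n dep_mono[of k n] by auto
      then show "dep k + 2 * r \<le> t" by simp
    qed
  qed
qed

text \<open>Keeps every AoI in \<open>{0..}\<close>, the domain on which \<open>f\<close> is assumed
  monotone.\<close>

lemma latest_timestamp_le:
  assumes "dep 1 \<le> t" "s \<in> {1..S}"
  shows "latest_timestamp M r dep u0 w s t \<le> t"
proof (cases "delivered M r dep w s t = {}")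
  case True
  then show ?thesis using u0_le[OF assms(2)] assms(1) by (simp add: latest_timestamp_def)
next
  case False
  then have "Max (delivered M r dep w s t) \<in> delivered M r dep w s t"
    by (intro Max_in) (auto simp: delivered_def)
  then show ?thesis using False r_pos by (auto simp: latest_timestamp_def delivered_def)
qed

text \<open>A delivery at the very moment of departure already counts, while the departing trip
  lands strictly later as \<open>r > 0\<close>. Hence the choice for trip \<open>Suc n\<close> is
  based on \<open>stamp v n\<close>.\<close>

lemma delivered_at_departure:
  assumes "n < M" "k \<in> {1..M}"
  shows "dep k + 2 * r \<le> dep (Suc n) \<longleftrightarrow> k \<le> n"
  using dep_less[of k "Suc n"] dep_mono[of "Suc n" k] assms r_pos
  by (cases "k \<le> n") auto

section \<open>Comparison at a fixed time\<close>

text \<open>Induction over deliveries. The largest AoI at a departure is the smallest stamp, and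
  both solutions write the same value \<open>dep (Suc n) + r\<close>, so
  \<open>replace_min_dominates\<close> yields the next permutation.\<close>

lemma greedy_dominates:
  assumes v: "v \<in> solutions S M" "visits_largest_aoi S M r dep u0 v"
    and w: "w \<in> solutions S M" and "n \<le> M"
  shows "\<exists>\<pi>. bij_betw \<pi> {1..S} {1..S} \<and> (\<forall>s\<in>{1..S}. stamp w n (\<pi> s) \<le> stamp v n s)"
  using \<open>n \<le> M\<close>
proof (induction n)
  case 0
  show ?case by (rule exI[of _ "\<lambda>s. s"]) (simp add: bij_betw_def)
next
  case (Suc n)
  then obtain \<pi> where \<pi>: "bij_betw \<pi> {1..S} {1..S}"
    "\<And>s. s \<in> {1..S} \<Longrightarrow> stamp w n (\<pi> s) \<le> stamp v n s"
    by auto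
  have "aoi M r dep u0 v s (dep (Suc n)) = dep (Suc n) - stamp v n s" for s
    using latest_timestamp_eq_stamp[of n "dep (Suc n)"] delivered_at_departure[of n] Suc.prems
    by (simp add: aoi_def)
  moreover have "aoi M r dep u0 v s (dep (Suc n)) \<le> aoi M r dep u0 v (v (Suc n)) (dep (Suc n))"
    if "s \<in> {1..S}" for s
    using v(2) Suc.prems that
    by (simp add: visits_largest_aoi_def is_arg_max_linorder)
  ultimately have "stamp v n (v (Suc n)) \<le> stamp v n s" if "s \<in> {1..S}" for s
    using that by simp
  moreover have "v (Suc n) \<in> {1..S}" "w (Suc n) \<in> {1..S}"
    using v(1) w Suc.prems by (auto simp: solutions_def Pi_iff)
  ultimately show ?case
    unfolding stamp.simps
    using \<pi> by (intro replace_min_dominates)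
qed

text \<open>Costs are compared node by node along \<open>\<pi>\<close>; summing over all nodes
  removes the permutation, which may vary with \<open>t\<close>.\<close>

lemma total_cost_le:
  fixes f :: "real \<Rightarrow> real"
  assumes v: "v \<in> solutions S M" "visits_largest_aoi S M r dep u0 v"
    and w: "w \<in> solutions S M" and f: "mono_on {0..} f" and t: "dep 1 \<le> t"
  shows "(\<Sum>s = 1..S. f (aoi M r dep u0 v s t)) \<le> (\<Sum>s = 1..S. f (aoi M r dep u0 w s t))"
proof -
  obtain n where n: "n \<le> M" "\<And>k. k \<in> {1..M} \<Longrightarrow> dep k + 2 * r \<le> t \<longleftrightarrow> k \<le> n"
    using ex_delivered_count by blast
  obtain \<pi> where \<pi>: "bij_betw \<pi> {1..S} {1..S}"
    "\<And>s. s \<in> {1..S} \<Longrightarrow> stamp w n (\<pi> s) \<le> stamp v n s"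
    using greedy_dominates[OF v w n(1)] by blast
  have aoi: "aoi M r dep u0 x s t = t - stamp x n s" for x s
    using latest_timestamp_eq_stamp[OF n] by (simp add: aoi_def)
  have "(\<Sum>s = 1..S. f (aoi M r dep u0 v s t)) \<le> (\<Sum>s = 1..S. f (aoi M r dep u0 w (\<pi> s) t))"
  proof (rule sum_mono)
    fix s assume s: "s \<in> {1..S}"
    have "0 \<le> aoi M r dep u0 v s t"
      using latest_timestamp_le[OF t s] by (simp add: aoi_def)
    moreover have "aoi M r dep u0 v s t \<le> aoi M r dep u0 w (\<pi> s) t"
      using \<pi>(2)[OF s] by (simp add: aoi)
    ultimately show "f (aoi M r dep u0 v s t) \<le> f (aoi M r dep u0 w (\<pi> s) t)"
      using f by (auto intro: mono_onD)
  qed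
  also have "\<dots> = (\<Sum>s = 1..S. f (aoi M r dep u0 w s t))"
    by (rule sum.reindex_bij_betw[OF \<pi>(1)])
  finally show ?thesis .
qed

section \<open>Integration over time\<close>

text \<open>Between deliveries the AoI is \<open>t\<close> minus a constant, so the cost is monotone
  there and thus integrable, even for discontinuous \<open>f\<close>.\<close>

lemma integrable_cost:
  fixes f :: "real \<Rightarrow> real"
  assumes f: "mono_on {0..} f" and s: "s \<in> {1..S}"
  shows "(\<lambda>t. f (aoi M r dep u0 w s t)) integrable_on {dep 1..T}"
proof -
  \<comment> \<open>Breakpoints: first departure, the \<open>M\<close> deliveries, then
    \<open>T\<close>. On \<open>[a n, a (Suc n))\<close> exactly \<open>n\<close> trips have been
    delivered.\<close>
  define a where "a n = (if n = 0 then dep 1 else if n \<le> M then dep n + 2 * r else T)" for n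
  have a_le: "a n \<le> a (Suc n)" if "n < Suc M" for n
  proof (cases "n = 0 \<or> n = M")
    case True
    then show ?thesis using M_ge r_pos T_ge by (auto simp: a_def)
  next
    case False
    then show ?thesis using that dep_mono[of n "Suc n"] by (auto simp: a_def)
  qed
  have "(\<lambda>t. f (aoi M r dep u0 w s t)) integrable_on {a n..a (Suc n)}" if "n < Suc M" for n
  proof -
    have ge: "dep 1 \<le> a n"
      using that r_pos dep_mono[of 1 n] by (auto simp: a_def)
    have eq: "latest_timestamp M r dep u0 w s t = stamp w n s" if t: "a n \<le> t" "t < a (Suc n)" for t
    proof (rule latest_timestamp_eq_stamp)
      show "n \<le> M" using \<open>n < Suc M\<close> by simp
      fix k assume k: "k \<in> {1..M}"
      show "dep k + 2 * r \<le> t \<longleftrightarrow> k \<le> n"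
        using k t \<open>n < Suc M\<close> dep_mono[of k n] dep_mono[of "Suc n" k]
        by (cases "k \<le> n") (auto simp: a_def split: if_splits)
    qed
    show ?thesis
    proof (cases "a n < a (Suc n)")
      case True
      have "stamp w n s \<le> a n"
        using eq[of "a n"] latest_timestamp_le[OF ge s, of w] True by simp
      then have "mono_on {a n..a (Suc n)} (\<lambda>t. f (t - stamp w n s))"
        by (auto intro!: mono_onI mono_onD[OF f])
      then have "(\<lambda>t. f (t - stamp w n s)) integrable_on {a n..a (Suc n)}"
        by (rule integrable_on_mono_on)
      \<comment> \<open>At the right endpoint the next delivery may already have changed the stamp;
        one point does not affect integrability.\<close>
      then show ?thesis
        by (rule integrable_spike_finite[where S = "{a (Suc n)}", rotated 2])
          (auto simp: aoi_def eq)
    next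
      \<comment> \<open>Occurs only for \<open>n = M\<close>, when \<open>T\<close> is the last
        delivery time.\<close>
      case False
      then have "a n = a (Suc n)" using a_le[OF that] by simp
      then show ?thesis by (metis integrable_on_refl box_real(2))
    qed
  qed
  then have "(\<lambda>t. f (aoi M r dep u0 w s t)) integrable_on {a 0..a (Suc M)}"
    using integrable_on_concat[of "Suc M" a] a_le by blast
  then show ?thesis by (simp add: a_def)
qed

text \<open>The sum moves inside the integral because only the total over all nodes, not the cost of
  a single node, is comparable pointwise.\<close>

lemma average_aoi_cost_eq:
  fixes f :: "real \<Rightarrow> real"
  assumes "mono_on {0..} f"
  shows "average_aoi_cost S M r dep u0 T f w =
    integral {dep 1..T} (\<lambda>t. \<Sum>s = 1..S. f (aoi M r dep u0 w s t)) / (T - dep 1) / real S"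
  unfolding average_aoi_cost_def sum_divide_distrib[symmetric]
  using integrable_cost[OF assms]
  by (subst Henstock_Kurzweil_Integration.integral_sum) auto

lemma greedy_average_aoi_cost_le:
  fixes f :: "real \<Rightarrow> real"
  assumes v: "v \<in> solutions S M" "visits_largest_aoi S M r dep u0 v"
    and w: "w \<in> solutions S M" and f: "mono_on {0..} f"
  shows "average_aoi_cost S M r dep u0 T f v \<le> average_aoi_cost S M r dep u0 T f w"
proof -
  have "integral {dep 1..T} (\<lambda>t. \<Sum>s = 1..S. f (aoi M r dep u0 v s t))
      \<le> integral {dep 1..T} (\<lambda>t. \<Sum>s = 1..S. f (aoi M r dep u0 w s t))"
    using total_cost_le[OF v w f] integrable_cost[OF f]
    by (intro integral_le Henstock_Kurzweil_Integration.integrable_sum) auto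
  moreover have "dep 1 \<le> T"
    using dep_mono[of 1 M] M_ge r_pos T_ge by simp
  ultimately show ?thesis
    unfolding average_aoi_cost_eq[OF f] by (intro divide_right_mono) auto
qed

end

theorem theorem3:
  fixes S M :: nat
    and r T :: real
    and dep u0 :: "nat \<Rightarrow> real"
    and f :: "real \<Rightarrow> real"
    and v :: "nat \<Rightarrow> nat"
  assumes "S \<ge> 1" and "M \<ge> 1" and "r > 0"
    and "\<And>k. 1 \<le> k \<Longrightarrow> k < M \<Longrightarrow> dep k + 2 * r \<le> dep (k + 1)"
    and "\<And>s. s \<in> {1..S} \<Longrightarrow> u0 s \<le> dep 1"
    and "dep M + 2 * r \<le> T"
    and "v \<in> solutions S M"
    and "visits_largest_aoi S M r dep u0 v"
  shows "is_arg_min (average_aoi S M r dep u0 T) (\<lambda>w. w \<in> solutions S M) v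
    \<and> (mono_on {0..} f \<longrightarrow>
         is_arg_min (average_aoi_cost S M r dep u0 T f) (\<lambda>w. w \<in> solutions S M) v)"
proof -
  interpret uav_trips S M r T dep u0
    using assms by unfold_locales
  have cost: "is_arg_min (average_aoi_cost S M r dep u0 T g) (\<lambda>w. w \<in> solutions S M) v"
    if "mono_on {0..} g" for g
    using greedy_average_aoi_cost_le[OF assms(7,8) _ that] assms(7)
    by (simp add: is_arg_min_linorder)
  have "average_aoi S M r dep u0 T = average_aoi_cost S M r dep u0 T (\<lambda>x. x)"
    by (simp add: fun_eq_iff average_aoi_def average_aoi_cost_def)
  then show ?thesis using cost by (simp add: mono_on_def)
qed

end
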